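(* Let $n=2$. The integral transformation $I(\alpha;s_1,s_2,q,t)$ and the difference operator $D(s_1,s_2,q,t)$ are commutative on the space ${\cal F}_2={\bf C}[[\zeta_2/\zeta_1]]$: $$[I(\alpha;s_1,s_2,q,t),\,D(s_1,s_2,q,t)]=0 .$$
   Context: Here $s_1,\dots,s_n$, $q$, $t$ and $\alpha$ are parameters. Standard notation for basic hypergeometric series is used: $(a;q)_\infty=\prod_{k\ge 0}(1-aq^k)$ and $\Theta_q(z)=(z;q)_\infty(q/z;q)_\infty(q;q)_\infty$. The integral transformation $I(\alpha)=I(\alpha;s_1,\dots,s_n,q,t)$ acts on the space of formal power series ${\cal F}_n={\bf C}[[\zeta_2/\zeta_1,\dots,\zeta_n/\zeta_{n-1}]]$ (here $n=2$) by $$I(\alpha) f(\zeta_1,\dots,\zeta_n)=\prod_{i=1}^n\left(\frac{(qt^{-1};q)_\infty}{(\alpha s_i^{-1}qt^{-1};q)_\infty}\frac{(q;q)_\infty}{(\alpha^{-1}s_iq;q)_\infty}\right)\prod_{i<j}h(\zeta_j/\zeta_i)\oint_{C_1}\!\cdots\oint_{C_n}\frac{d\xi_1}{2\pi i\,\xi_1}\cdots\frac{d\xi_n}{2\pi i\,\xi_n}\ \prod_{i=1}^n\frac{\Theta_q(\alpha s_i^{-1}q^{1/2}t^{-1/2}\zeta_i/\xi_i)}{\Theta_q(q^{1/2}t^{-1/2}\zeta_i/\xi_i)}\ \prod_{k=1}^n\Big[\prod_{i<k}g(\zeta_k/\xi_i)\prod_{j\ge k}g(\xi_j/\zeta_k)\Big]f(\xi_1,\dots,\xi_n),$$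 where the integration contours $C_i$ are given by the conditions $|\zeta_i/\xi_i|=1$, and $$h(\zeta)=(1-\zeta)\frac{(qt^{-1}\zeta;q)_\infty}{(t\zeta;q)_\infty},\qquad g(\zeta)=\frac{(q^{1/2}t^{1/2}\zeta;q)_\infty}{(q^{1/2}t^{-1/2}\zeta;q)_\infty}.$$ The difference operator on ${\cal F}_n$ (here $n=2$) is $$D=D(s_1,\dots,s_n,q,t)=\sum_{i=1}^n s_i\prod_{j<i}\theta_-(\zeta_i/\zeta_j)\prod_{j>i}\theta_+(\zeta_j/\zeta_i)\cdot T_{q^{-1},\zeta_i},$$ where $\theta_\pm(\zeta)$ are the series $\theta_\pm(\zeta)=\frac{1-q^{\pm1}t^{\mp1}\zeta}{1-q^{\pm1}\zeta}=1+\sum_{m\ge1}(1-t^{\mp1})q^{\pm m}\zeta^m$, and $T_{x,\zeta_i}$ replaces $\zeta_i$ by $x\zeta_i$.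
   Formalization: Proved for 0<|q|<1 and |q|<|t| (so that g converges on the contours |ζ_i/ξ_i|=1), with nonzero parameters and prefactor denominators; for |t|<|q| the claim can fail, e.g. q=1/4, t=1/32, s_1=s_2=α=1. *)

theory Defs
  imports "HOL-Complex_Analysis.Complex_Analysis"
begin

text \<open>
  The space C[[zeta2/zeta1]] is represented by the type \<^typ>\<open>complex fps\<close>, whose indeterminate
  \<^const>\<open>fps_X\<close> stands for x = zeta2/zeta1.  The formulas below are the case n = 2.

  The half-integer powers of q and t are determined only up to sign.  The arguments qh and th
  stand for arbitrary chosen square roots of q and t.
\<close>

definition qpoch_inf :: "complex \<Rightarrow> complex \<Rightarrow> complex" where
  "qpoch_inf a q = (\<Prod>k. 1 - a * q ^ k)"

definition Theta :: "complex \<Rightarrow> complex \<Rightarrow> complex" where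
  "Theta q z = qpoch_inf z q * qpoch_inf (q / z) q * qpoch_inf q q"

definition h_fun :: "complex \<Rightarrow> complex \<Rightarrow> complex \<Rightarrow> complex" where
  "h_fun q t z = (1 - z) * qpoch_inf (q / t * z) q / qpoch_inf (t * z) q"

definition g_fun :: "complex \<Rightarrow> complex \<Rightarrow> complex \<Rightarrow> complex \<Rightarrow> complex" where
  "g_fun q qh th z = qpoch_inf (qh * th * z) q / qpoch_inf (qh / th * z) q"

definition fps_scale :: "complex \<Rightarrow> complex fps \<Rightarrow> complex fps" where
  "fps_scale c f = f oo (fps_const c * fps_X)"

text \<open>
  Since |xi_i/zeta_i| = 1 on the contour, we use u_i = xi_i/zeta_i as integration variables;
  d xi_i / xi_i = d u_i / u_i, and both contours become the unit circle.  In these variables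
  zeta2/xi1 = x/u1, xi2/zeta1 = u2 x and xi2/xi1 = (u2/u1) x, so for fixed u1, u2 the integrand
  is a formal power series in x.  The factors g(xi1/zeta1) = g(u1) and g(xi2/zeta2) = g(u2) do not
  involve x.
\<close>

definition I_integrand ::
  "complex \<Rightarrow> complex \<Rightarrow> complex \<Rightarrow> complex \<Rightarrow> complex \<Rightarrow> complex \<Rightarrow>
   complex fps \<Rightarrow> complex \<Rightarrow> complex \<Rightarrow> complex fps" where
  "I_integrand \<alpha> s1 s2 q qh th f u1 u2 =
     fps_const (Theta q (\<alpha> / s1 * (qh / th) * (1 / u1)) / Theta q (qh / th * (1 / u1))) *
     fps_const (Theta q (\<alpha> / s2 * (qh / th) * (1 / u2)) / Theta q (qh / th * (1 / u2))) *
     (fps_const (g_fun q qh th u1) * fps_scale u2 (fps_expansion (g_fun q qh th) 0)) *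
     (fps_scale (1 / u1) (fps_expansion (g_fun q qh th) 0) * fps_const (g_fun q qh th u2)) *
     fps_scale (u2 / u1) f"

text \<open>
  The integral of a formal power series in x is taken coefficientwise.
\<close>

definition torus_integral :: "(complex \<Rightarrow> complex \<Rightarrow> complex fps) \<Rightarrow> complex fps" where
  "torus_integral F = Abs_fps (\<lambda>m.
     contour_integral (circlepath 0 1) (\<lambda>u1.
       contour_integral (circlepath 0 1) (\<lambda>u2.
         fps_nth (F u1 u2) m / (2 * of_real pi * \<i> * u2)) / (2 * of_real pi * \<i> * u1)))"

definition I_factor :: "complex \<Rightarrow> complex \<Rightarrow> complex \<Rightarrow> complex \<Rightarrow> complex" where
  "I_factor \<alpha> s q t =
     (qpoch_inf (q / t) q / qpoch_inf (\<alpha> / s * q / t) q) *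
     (qpoch_inf q q / qpoch_inf (s / \<alpha> * q) q)"

definition I_op ::
  "complex \<Rightarrow> complex \<Rightarrow> complex \<Rightarrow> complex \<Rightarrow> complex \<Rightarrow> complex \<Rightarrow> complex \<Rightarrow>
   complex fps \<Rightarrow> complex fps" where
  "I_op \<alpha> s1 s2 q t qh th f =
     fps_const (I_factor \<alpha> s1 q t * I_factor \<alpha> s2 q t) * fps_expansion (h_fun q t) 0 *
     torus_integral (I_integrand \<alpha> s1 s2 q qh th f)"

definition theta_plus :: "complex \<Rightarrow> complex \<Rightarrow> complex fps" where
  "theta_plus q t = (1 - fps_const (q / t) * fps_X) / (1 - fps_const q * fps_X)"

definition theta_minus :: "complex \<Rightarrow> complex \<Rightarrow> complex fps" where
  "theta_minus q t = (1 - fps_const (t / q) * fps_X) / (1 - fps_const (1 / q) * fps_X)"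

text \<open>
  Replacing zeta1 by p zeta1 turns x into x/p; replacing zeta2 by p zeta2 turns x into p x.
\<close>

definition T1 :: "complex \<Rightarrow> complex fps \<Rightarrow> complex fps" where
  "T1 p f = fps_scale (1 / p) f"

definition T2 :: "complex \<Rightarrow> complex fps \<Rightarrow> complex fps" where
  "T2 p f = fps_scale p f"

definition D_op ::
  "complex \<Rightarrow> complex \<Rightarrow> complex \<Rightarrow> complex \<Rightarrow> complex fps \<Rightarrow> complex fps" where
  "D_op s1 s2 q t f =
     fps_const s1 * theta_plus q t * T1 (1 / q) f +
     fps_const s2 * theta_minus q t * T2 (1 / q) f"

end

theory Submission
  imports Defs
begin

text \<open>
  Put a = qh / th, v = 1 / u1, w = u2 and c_i = \<alpha> / s_i.  The zeros of g cancel one factor of the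
  theta function in the denominator, so each variable u_i carries the weight
  (c a / u)(q u / (c a)) / ((a / u)(a u)), where (x) means (x; q)_\<infinity> and c = c_i.  Moving the
  contour from |u| = 1 to |u| = |q| gives, for polynomials p, the two relations
  <(1 - a v) p(q v)> = (c_1 / t) <(1 - v / a) p(v)> and <(1 - w / a) p(w)> = c_2 <(1 - a w) p(q w)>
  for the weighted integrals < >.

  By the q-difference equations of g and h, the s_1-part and the s_2-part of the commutator are
  integrals of multiples of (1 - a v)(1 - a w) Z(q v, w) and (1 - v / a)(1 - w / a) Z(v, w / q) for
  one and the same series Z.  The first relation (for v) and the second one (for w) turn both into
  multiples of the integral of (1 - v / a)(1 - a w) Z(v, w), and their coefficients cancel.
\<close>

subsection \<open>The infinite q-Pochhammer symbol\<close>

lemma convergent_prod_qpoch: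
  assumes "norm (q::complex) < 1"
  shows "convergent_prod (\<lambda>k. 1 - a * q ^ k)"
proof -
  have "summable (\<lambda>k. norm ((1 - a * q ^ k) - 1))"
    using assms by (simp add: norm_mult norm_power summable_mult summable_geometric)
  then show ?thesis
    by (intro abs_convergent_prod_imp_convergent_prod summable_imp_abs_convergent_prod)
qed

lemma qpoch_inf_rec:
  assumes "norm q < 1"
  shows "qpoch_inf a q = (1 - a) * qpoch_inf (a * q) q"
proof -
  have lim: "(\<lambda>n. \<Prod>i\<le>n. 1 - a * q ^ i) \<longlonglongrightarrow> qpoch_inf a q" for a
    unfolding qpoch_inf_def by (intro convergent_prod_LIMSEQ convergent_prod_qpoch assms)
  have "(\<lambda>n. \<Prod>i\<le>Suc n. 1 - a * q ^ i) \<longlonglongrightarrow> qpoch_inf a q"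
    using lim[of a] by (rule LIMSEQ_Suc)
  also have "(\<lambda>n. \<Prod>i\<le>Suc n. 1 - a * q ^ i) = (\<lambda>n. (1 - a) * (\<Prod>i\<le>n. 1 - (a * q) * q ^ i))"
    by (simp only: prod.atMost_Suc_shift power_Suc power_0 mult_1_right mult.assoc)
  finally have *: "\<dots> \<longlonglongrightarrow> qpoch_inf a q" .
  have "(\<lambda>n. (1 - a) * (\<Prod>i\<le>n. 1 - (a * q) * q ^ i)) \<longlonglongrightarrow> (1 - a) * qpoch_inf (a * q) q"
    by (intro tendsto_intros lim)
  with * show ?thesis
    by (rule LIMSEQ_unique)
qed

lemma qpoch_inf_eq_0_iff:
  assumes "norm q < 1"
  shows "qpoch_inf a q = 0 \<longleftrightarrow> (\<exists>k. a * q ^ k = 1)"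
proof -
  have "(\<lambda>k. 1 - a * q ^ k) has_prod qpoch_inf a q"
    unfolding qpoch_inf_def
    using convergent_prod_qpoch[OF assms] by (rule convergent_prod_has_prod)
  from has_prod_eq_0_iff[OF this] have "qpoch_inf a q = 0 \<longleftrightarrow> (\<exists>k. 0 = 1 - a * q ^ k)"
    by (simp add: image_iff)
  then show ?thesis
    by (metis eq_iff_diff_eq_0)
qed

lemma qpoch_inf_nonzero:
  assumes "norm q < 1" "norm a < 1"
  shows "qpoch_inf a q \<noteq> 0"
proof
  assume "qpoch_inf a q = 0"
  then obtain k where "a * q ^ k = 1" using qpoch_inf_eq_0_iff[OF assms(1)] by blast
  then have "norm (a * q ^ k) = 1" by (metis norm_one)
  moreover have "norm (a * q ^ k) \<le> norm a * 1"
    unfolding norm_mult norm_power using assms by (intro mult_left_mono power_le_one) auto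
  ultimately show False using assms by simp
qed

lemma holomorphic_on_qpoch_inf:
  assumes "norm q < 1"
  shows "(\<lambda>a. qpoch_inf a q) holomorphic_on A"
proof (rule holomorphic_on_subset)
  let ?P = "\<lambda>N a. \<Prod>n<N. 1 - a * q ^ n"
  show "(\<lambda>a. qpoch_inf a q) holomorphic_on UNIV"
  proof (rule holomorphic_uniform_sequence)
    fix z :: complex
    define R where "R = norm z + 1"
    have "uniformly_convergent_on (cball 0 R) ?P"
    proof (rule uniformly_convergent_on_prod')
      have "norm (norm (1 - a * q ^ n - 1)) \<le> R * norm q ^ n" if "a \<in> cball 0 R" for n a
        using that by (simp add: norm_mult norm_power mult_right_mono)
      moreover have "summable (\<lambda>n. R * norm q ^ n)"
        using assms by (intro summable_mult summable_geometric) auto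
      ultimately show "uniformly_convergent_on (cball 0 R) (\<lambda>N a. \<Sum>n<N. norm (1 - a * q ^ n - 1))"
        using Weierstrass_m_test'[of "cball 0 R" "\<lambda>n a. norm (1 - a * q ^ n - 1)" "\<lambda>n. R * norm q ^ n"]
        by blast
    qed (auto intro!: continuous_intros)
    then obtain g where g: "uniform_limit (cball 0 R) ?P g sequentially"
      by (auto simp: uniformly_convergent_on_def)
    have "g a = qpoch_inf a q" if "a \<in> cball 0 R" for a
    proof -
      have "(\<lambda>n. ?P n a) \<longlonglongrightarrow> g a"
        using g that by (rule tendsto_uniform_limitI)
      moreover have "(\<lambda>n. ?P n a) \<longlonglongrightarrow> qpoch_inf a q"
        unfolding qpoch_inf_def
        using convergent_prod_LIMSEQ[OF convergent_prod_qpoch[OF assms, of a]]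
        by (simp add: LIMSEQ_lessThan_iff_atMost)
      ultimately show ?thesis by (rule LIMSEQ_unique)
    qed
    then have "uniform_limit (cball 0 R) ?P (\<lambda>a. qpoch_inf a q) sequentially"
      using g uniform_limit_cong'[of "cball 0 R" ?P ?P g "\<lambda>a. qpoch_inf a q" sequentially] by blast
    then have "uniform_limit (cball z 1) ?P (\<lambda>a. qpoch_inf a q) sequentially"
      by (rule uniform_limit_on_subset) (simp add: cball_subset_cball_iff R_def)
    then show "\<exists>d>0. cball z d \<subseteq> UNIV \<and> uniform_limit (cball z d) ?P (\<lambda>a. qpoch_inf a q) sequentially"
      by (intro exI[of _ 1]) auto
  qed (auto intro!: holomorphic_intros)
qed auto

lemma holomorphic_on_qpoch_inf' [holomorphic_intros]:
  assumes "norm q < 1" "f holomorphic_on A"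
  shows "(\<lambda>z. qpoch_inf (f z) q) holomorphic_on A"
  using holomorphic_on_compose_gen[OF assms(2) holomorphic_on_qpoch_inf[OF assms(1), of UNIV]]
  by (simp add: o_def)

lemma qpoch_inf_quasi_period:
  assumes "norm q < 1" "z \<noteq> 0"
  shows "qpoch_inf z q * qpoch_inf (q / z) q = - z * (qpoch_inf (z * q) q * qpoch_inf (1 / z) q)"
proof -
  define x y where "x = qpoch_inf (z * q) q" and "y = qpoch_inf (q / z) q"
  have *: "qpoch_inf z q = (1 - z) * x" "qpoch_inf (1 / z) q = (1 - 1 / z) * y"
    using qpoch_inf_rec[OF assms(1), of z] qpoch_inf_rec[OF assms(1), of "1 / z"]
    by (simp_all add: x_def y_def)
  show ?thesis
    unfolding x_def[symmetric] y_def[symmetric] * using assms(2) by (simp add: field_simps)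
qed

subsection \<open>Contour shift\<close>

lemma contour_integral_circlepath_mult:
  fixes q :: complex
  assumes hol: "\<psi> holomorphic_on {w. r < norm w \<and> norm w < R}"
    and q: "q \<noteq> 0" "r < norm q" "norm q \<le> 1" and R: "1 < R"
  shows "contour_integral (circlepath 0 1) \<psi> = contour_integral (circlepath 0 1) (\<lambda>u. q * \<psi> (q * u))"
proof -
  let ?S = "{w. r < norm w \<and> norm w < R}"
  define \<gamma> where "\<gamma> = (\<lambda>t::real. q * circlepath 0 1 t)"
  have der: "(\<gamma> has_vector_derivative q * vector_derivative (circlepath 0 1) (at t)) (at t)" for t
    unfolding \<gamma>_def
    by (intro has_vector_derivative_mult_right)
       (simp add: circlepath_def vector_derivative_works[symmetric] differentiable_part_circlepath)
  have "homotopic_loops ?S (circlepath 0 1) \<gamma>"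
  proof -
    define h :: "real \<times> real \<Rightarrow> complex"
      where "h = (\<lambda>z. exp (of_real (fst z) * Ln q) * circlepath 0 1 (snd z))"
    have norm_h: "norm (h (s, x)) = norm q powr s" for s x
      using q by (simp add: h_def norm_mult circlepath powr_def)
    have "norm q powr s \<in> {norm q..1}" if "s \<in> {0..1}" for s
      using that q powr_mono'[of s 1 "norm q"] powr_le1[of s "norm q"]
      by auto
    then have "h \<in> {0..1} \<times> {0..1} \<rightarrow> ?S"
      using q R by (auto simp: norm_h) fastforce+
    moreover have "continuous_on ({0..1} \<times> {0..1}) h"
      unfolding h_def circlepath by (auto intro!: continuous_intros)
    moreover have "pathfinish (h \<circ> Pair s) = pathstart (h \<circ> Pair s)" for s
      by (simp add: h_def pathfinish_def pathstart_def circlepath)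
    ultimately show ?thesis
      unfolding homotopic_loops using q by (intro exI[of _ h]) (auto simp: h_def \<gamma>_def)
  qed
  moreover have "open ?S"
    by (intro open_Collect_conj open_Collect_less continuous_intros)
  moreover have "valid_path \<gamma>"
  proof -
    have "valid_path ((\<lambda>w. q * w) \<circ> circlepath 0 1)"
      by (rule valid_path_compose_holomorphic[where S = UNIV]) (auto intro!: holomorphic_intros)
    then show ?thesis by (simp add: \<gamma>_def o_def)
  qed
  ultimately have "contour_integral (circlepath 0 1) \<psi> = contour_integral \<gamma> \<psi>"
    using hol Cauchy_theorem_homotopic_loops valid_path_circlepath by blast
  also have "\<dots> = contour_integral (circlepath 0 1) (\<lambda>u. q * \<psi> (q * u))"
    unfolding contour_integral_integral
    by (simp add: vector_derivative_at[OF der] mult_ac) (simp add: \<gamma>_def mult_ac)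
  finally show ?thesis .
qed

definition theta_kernel :: "complex \<Rightarrow> complex \<Rightarrow> complex \<Rightarrow> complex \<Rightarrow> complex" where
  "theta_kernel q a c u =
     qpoch_inf (c * a / u) q * qpoch_inf (q * u / (c * a)) q / (qpoch_inf (a / u) q * qpoch_inf (a * u) q)"

definition moment :: "complex \<Rightarrow> complex \<Rightarrow> complex \<Rightarrow> int \<Rightarrow> complex" where
  "moment q a c n = contour_integral (circlepath 0 1) (\<lambda>u. theta_kernel q a c u * u powi n / (2 * of_real pi * \<i> * u))"

lemma theta_kernel_contour_integrable:
  assumes q: "norm q < 1" and a: "norm a < 1"
  shows "(\<lambda>u. theta_kernel q a c u * u powi n / (2 * of_real pi * \<i> * u)) contour_integrable_on circlepath 0 1"
proof (rule contour_integrable_holomorphic_simple)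
  let ?S = "{u. norm a < norm u \<and> norm (a * u) < 1}"
  show "open ?S" by (intro open_Collect_conj open_Collect_less continuous_intros)
  show "path_image (circlepath 0 1) \<subseteq> ?S"
    using a by (auto simp: norm_mult)
  have 0: "0 \<notin> ?S" using norm_ge_zero[of a] by auto
  have "qpoch_inf (a / u) q \<noteq> 0" "qpoch_inf (a * u) q \<noteq> 0" if "u \<in> ?S" for u
  proof -
    have "u \<noteq> 0" using that 0 by blast
    then have "norm (a / u) < 1" using that by (simp add: norm_divide)
    then show "qpoch_inf (a / u) q \<noteq> 0" by (rule qpoch_inf_nonzero[OF q])
    show "qpoch_inf (a * u) q \<noteq> 0" using that by (intro qpoch_inf_nonzero q) simp
  qed
  then show "(\<lambda>u. theta_kernel q a c u * u powi n / (2 * of_real pi * \<i> * u)) holomorphic_on ?S"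
    unfolding theta_kernel_def using 0 q
    by (cases "c * a = 0") (auto intro!: holomorphic_intros)
qed auto

lemma moment_recurrence:
  assumes q: "q \<noteq> 0" "norm q < 1" and a: "a \<noteq> 0" "norm a < 1" and c: "c \<noteq> 0"
  shows "moment q a c n - a * moment q a c (n - 1) =
         - (c * a / q) * q powi n * (moment q a c (n - 1) - a * moment q a c n)"
proof -
  let ?C = "circlepath 0 1" and ?d = "\<lambda>u. 2 * complex_of_real pi * \<i> * u"
  define F where "F = (\<lambda>u. qpoch_inf (c * a / u) q * qpoch_inf (q * u / (c * a)) q /
                            (qpoch_inf (a * q / u) q * qpoch_inf (a * u) q))"
  let ?\<psi> = "\<lambda>u. F u * u powi n / ?d u"
  let ?S = "{u. norm (a * q) < norm u \<and> norm u < 1 / norm a}"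
  have F1: "F u = (1 - a / u) * theta_kernel q a c u" if "norm u = 1" for u
  proof -
    define d where "d = 1 - a / u"
    have "u \<noteq> 0" "u \<noteq> a" using that a by auto
    then have "d \<noteq> 0" by (simp add: d_def)
    then show ?thesis
      unfolding F_def theta_kernel_def qpoch_inf_rec[OF q(2), of "a / u"] d_def[symmetric]
      by simp
  qed
  have F2: "F (q * u) = - (c * a / (q * u)) * (1 - a * u) * theta_kernel q a c u" if "norm u = 1" for u
  proof -
    have u: "u \<noteq> 0" using that by auto
    have "a * u \<noteq> 1"
    proof
      assume "a * u = 1" then have "norm (a * u) = 1" by simp
      then show False using that a by (simp add: norm_mult)
    qed
    then have "1 - a * u \<noteq> 0" by simp
    moreover have "qpoch_inf (c * a / (q * u)) q * qpoch_inf (q * (q * u) / (c * a)) q =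
      - (c * a / (q * u)) * (qpoch_inf (c * a / u) q * qpoch_inf (q * u / (c * a)) q)"
      using qpoch_inf_quasi_period[OF q(2), of "c * a / (q * u)"] q a c u by simp
    ultimately show ?thesis
      unfolding F_def theta_kernel_def using qpoch_inf_rec[OF q(2), of "a * u"] q
      by (simp add: mult_ac)
  qed
  have 0: "0 \<notin> ?S" using norm_ge_zero[of "a * q"] by (auto simp del: norm_ge_zero)
  have hol: "?\<psi> holomorphic_on ?S"
  proof -
    have "qpoch_inf (a * q / u) q \<noteq> 0" "qpoch_inf (a * u) q \<noteq> 0" if "u \<in> ?S" for u
    proof -
      have "u \<noteq> 0" using that 0 by auto
      then show "qpoch_inf (a * q / u) q \<noteq> 0"
        using that by (intro qpoch_inf_nonzero q) (auto simp: norm_divide divide_less_eq_1)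
      show "qpoch_inf (a * u) q \<noteq> 0"
        using that a by (intro qpoch_inf_nonzero q) (auto simp: norm_mult field_simps)
    qed
    then show ?thesis
      unfolding F_def using 0 q a c by (auto intro!: holomorphic_intros)
  qed
  have mom: "((\<lambda>u. theta_kernel q a c u * u powi n / ?d u) has_contour_integral moment q a c n) ?C" for n
    unfolding moment_def by (intro has_contour_integral_integral theta_kernel_contour_integrable q a)
  have "contour_integral ?C ?\<psi> = contour_integral ?C (\<lambda>u. q * ?\<psi> (q * u))"
    by (rule contour_integral_circlepath_mult[OF hol])
       (use q a in \<open>auto simp: norm_mult less_divide_eq\<close>)
  also have "contour_integral ?C ?\<psi> = contour_integral ?C
      (\<lambda>u. theta_kernel q a c u * u powi n / ?d u - a * (theta_kernel q a c u * u powi (n - 1) / ?d u))"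
  proof (intro contour_integral_eq)
    fix u assume "u \<in> path_image ?C"
    then have u: "norm u = 1" "u \<noteq> 0" by auto
    then show "?\<psi> u = theta_kernel q a c u * u powi n / ?d u - a * (theta_kernel q a c u * u powi (n - 1) / ?d u)"
      by (simp add: F1 power_int_diff field_simps)
  qed
  also have "\<dots> = moment q a c n - a * moment q a c (n - 1)"
    by (intro contour_integral_unique has_contour_integral_diff has_contour_integral_lmul mom)
  also have "contour_integral ?C (\<lambda>u. q * ?\<psi> (q * u)) = contour_integral ?C
      (\<lambda>u. - (c * a / q) * q powi n * (theta_kernel q a c u * u powi (n - 1) / ?d u - a * (theta_kernel q a c u * u powi n / ?d u)))"
  proof (intro contour_integral_eq)
    fix u assume "u \<in> path_image ?C"
    then have u: "norm u = 1" "u \<noteq> 0" by auto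
    then show "q * ?\<psi> (q * u) =
      - (c * a / q) * q powi n * (theta_kernel q a c u * u powi (n - 1) / ?d u - a * (theta_kernel q a c u * u powi n / ?d u))"
      using q by (simp add: F2 power_int_diff power_int_mult_distrib field_simps)
  qed
  also have "\<dots> = - (c * a / q) * q powi n * (moment q a c (n - 1) - a * moment q a c n)"
    by (intro contour_integral_unique has_contour_integral_diff has_contour_integral_lmul mom)
  finally show ?thesis .
qed

lemma has_contour_integral_circlepath_spike:
  assumes "(f has_contour_integral y) (circlepath 0 1)"
    and "\<And>u. norm u = 1 \<Longrightarrow> u \<noteq> p \<Longrightarrow> g u = f u"
  shows "(g has_contour_integral y) (circlepath 0 1)"
proof -
  define T where "T = {x \<in> {0..1}. circlepath 0 1 x = p}"
  have inj: "x = y \<or> x = 0 \<or> x = 1" if "x \<in> T" "y \<in> T" for x y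
  proof -
    have "loop_free (circlepath 0 1)"
      using simple_path_circlepath[of 0 1] by (simp add: simple_path_def)
    moreover have "x \<in> {0..1}" "y \<in> {0..1}" "circlepath 0 1 x = circlepath 0 1 y"
      using that by (simp_all add: T_def)
    ultimately show ?thesis
      unfolding loop_free_def by blast
  qed
  have "finite T"
  proof (cases "T \<subseteq> {0, 1}")
    case False
    then obtain x where "x \<in> T" "x \<noteq> 0" "x \<noteq> 1" by blast
    then have "T \<subseteq> {x}" using inj by blast
    then show ?thesis using finite_subset by blast
  next
    case True
    then show ?thesis by (rule finite_subset) simp
  qed
  moreover have "g (circlepath 0 1 x) * vector_derivative (circlepath 0 1) (at x) =
      f (circlepath 0 1 x) * vector_derivative (circlepath 0 1) (at x)" if "x \<in> {0..1} - T" for x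
  proof -
    have "norm (circlepath 0 1 x) = 1" by (simp add: circlepath)
    moreover have "circlepath 0 1 x \<noteq> p" using that by (simp add: T_def)
    ultimately show ?thesis using assms(2) by simp
  qed
  ultimately show ?thesis
    using assms(1) unfolding has_contour_integral by (rule has_integral_spike_finite)
qed

subsection \<open>Formal power series and q-difference equations\<close>

lemma fps_scale_nth [simp]: "fps_nth (fps_scale c f) n = c ^ n * fps_nth f n"
  by (simp add: fps_scale_def fps_compose_linear)

lemma fps_scale_mult: "fps_scale c (f * g) = fps_scale c f * fps_scale c g"
  unfolding fps_scale_def by (intro fps_compose_mult_distrib) simp

lemma fps_scale_diff: "fps_scale c (f - g) = fps_scale c f - fps_scale c g"
  by (simp add: fps_eq_iff algebra_simps)

lemma fps_scale_add: "fps_scale c (f + g) = fps_scale c f + fps_scale c g"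
  by (simp add: fps_eq_iff algebra_simps)

lemma fps_scale_1 [simp]: "fps_scale c 1 = 1"
  by (simp add: fps_eq_iff)

lemma fps_scale_const [simp]: "fps_scale c (fps_const x) = fps_const x"
  by (simp add: fps_eq_iff)

lemma fps_scale_X [simp]: "fps_scale c fps_X = fps_const c * fps_X"
  by (simp add: fps_eq_iff fps_X_def)

lemma fps_scale_scale: "fps_scale c (fps_scale d f) = fps_scale (c * d) f"
  by (simp add: fps_eq_iff power_mult_distrib mult_ac)

lemma fps_scale_by_1 [simp]: "fps_scale 1 f = f"
  by (simp add: fps_eq_iff)

lemma has_fps_expansion_scale:
  assumes "f has_fps_expansion F"
  shows "(\<lambda>z. f (c * z)) has_fps_expansion fps_scale c F"
  using has_fps_expansion_compose[of f F "\<lambda>z. c * z" "fps_const c * fps_X"] assms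
  by (simp add: fps_scale_def o_def has_fps_expansion_cmult_left has_fps_expansion_fps_X)

lemma has_fps_expansion_linear:
  "(\<lambda>z. 1 - c * z) has_fps_expansion 1 - fps_const c * (fps_X :: complex fps)"
  by (intro has_fps_expansion_diff has_fps_expansion_1 has_fps_expansion_cmult_left has_fps_expansion_fps_X)

lemma fps_expansion_mult_eqI:
  assumes f: "f analytic_on {0}" and A: "A has_fps_expansion A'" and B: "B has_fps_expansion B'"
    and eq: "eventually (\<lambda>z. A z * f z = B z * f (q * z)) (nhds 0)"
  shows "A' * fps_expansion f 0 = B' * fps_scale q (fps_expansion f 0)"
proof (rule fps_expansion_unique_complex)
  have f: "f has_fps_expansion fps_expansion f 0"
    using f by (rule analytic_at_imp_has_fps_expansion_0)
  show "(\<lambda>z. B z * f (q * z)) has_fps_expansion B' * fps_scale q (fps_expansion f 0)"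
    by (intro has_fps_expansion_mult has_fps_expansion_scale f B)
  have "(\<lambda>z. A z * f z) has_fps_expansion A' * fps_expansion f 0"
    by (intro has_fps_expansion_mult f A)
  then show "(\<lambda>z. B z * f (q * z)) has_fps_expansion A' * fps_expansion f 0"
    using has_fps_expansion_cong[OF eq refl] by blast
qed

lemma open_linear_ball: "open {z::complex. norm (c * z) < 1}"
  by (intro open_Collect_less continuous_intros)

lemma eventually_linear_ball: "eventually (\<lambda>z::complex. norm (c * z) < 1) (nhds 0)"
  using eventually_nhds_in_open[OF open_linear_ball[of c], of 0] by simp

lemma g_fun_fps_expansion:
  fixes q qh th :: complex
  assumes q: "norm q < 1"
  defines "G \<equiv> fps_expansion (g_fun q qh th) 0"
  shows "(1 - fps_const (qh / th) * fps_X) * G = (1 - fps_const (qh * th) * fps_X) * fps_scale q G"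
  unfolding G_def
proof (rule fps_expansion_mult_eqI)
  let ?a = "qh / th"
  have "g_fun q qh th holomorphic_on {z. norm (?a * z) < 1}"
    unfolding g_fun_def by (intro holomorphic_intros q) (use qpoch_inf_nonzero[OF q] in blast)
  then show "g_fun q qh th analytic_on {0}"
    using open_linear_ball[of ?a] by (auto simp: analytic_at)
  have "(1 - ?a * z) * g_fun q qh th z = (1 - qh * th * z) * g_fun q qh th (q * z)"
    if "norm (?a * z) < 1" for z
  proof -
    define d where "d = 1 - ?a * z"
    have "?a * z \<noteq> 1" using that by (metis norm_one less_irrefl)
    then have "d \<noteq> 0" by (simp add: d_def)
    then show ?thesis
      unfolding g_fun_def qpoch_inf_rec[OF q, of "?a * z"] qpoch_inf_rec[OF q, of "qh * th * z"] d_def[symmetric]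
      by (simp add: mult_ac)
  qed
  then show "\<forall>\<^sub>F z in nhds 0. (1 - ?a * z) * g_fun q qh th z = (1 - qh * th * z) * g_fun q qh th (q * z)"
    using eventually_linear_ball[of ?a] by (auto elim: eventually_mono)
qed (rule has_fps_expansion_linear)+

lemma h_fun_fps_expansion:
  fixes q t :: complex
  assumes q: "norm q < 1"
  defines "H \<equiv> fps_expansion (h_fun q t) 0"
  shows "(1 - fps_const q * fps_X) * (1 - fps_const t * fps_X) * H =
         (1 - fps_X) * (1 - fps_const (q / t) * fps_X) * fps_scale q H"
  unfolding H_def
proof (rule fps_expansion_mult_eqI)
  have "h_fun q t holomorphic_on {z. norm (t * z) < 1}"
    unfolding h_fun_def by (intro holomorphic_intros q) (use qpoch_inf_nonzero[OF q] in blast)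
  then show "h_fun q t analytic_on {0}"
    using open_linear_ball[of t] by (auto simp: analytic_at)
  have "(1 - q * z) * (1 - t * z) * h_fun q t z = (1 - 1 * z) * (1 - q / t * z) * h_fun q t (q * z)"
    if "norm (t * z) < 1" for z
  proof -
    define d where "d = 1 - t * z"
    have "t * z \<noteq> 1" using that by (metis norm_one less_irrefl)
    then have "d \<noteq> 0" by (simp add: d_def)
    then show ?thesis
      unfolding h_fun_def qpoch_inf_rec[OF q, of "t * z"] qpoch_inf_rec[OF q, of "q / t * z"] d_def[symmetric]
      by (simp add: mult_ac)
  qed
  then show "\<forall>\<^sub>F z in nhds 0. (1 - q * z) * (1 - t * z) * h_fun q t z =
      (1 - 1 * z) * (1 - q / t * z) * h_fun q t (q * z)"
    using eventually_linear_ball[of t] by (auto elim: eventually_mono)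
  show "(\<lambda>z. (1 - 1 * z) * (1 - q / t * z)) has_fps_expansion (1 - fps_X) * (1 - fps_const (q / t) * fps_X)"
    using has_fps_expansion_mult[OF has_fps_expansion_linear[of 1] has_fps_expansion_linear[of "q / t"]]
    by simp
qed (intro has_fps_expansion_mult has_fps_expansion_linear)

lemma theta_plus_mult: "(1 - fps_const q * fps_X) * theta_plus q t = 1 - fps_const (q / t) * fps_X"
  unfolding theta_plus_def by (simp add: fps_divide_unit mult.left_commute inverse_mult_eq_1')

lemma theta_minus_eq: "theta_minus q t = theta_plus (1 / q) (1 / t)"
  by (simp add: theta_minus_def theta_plus_def)

lemma bracket_polynomial_identity:
  fixes a t v w x :: "'a :: idom"
  shows "(1 - x) * (1 - a * t * w * x) * (1 - a * t * v * x) * (1 - a * a * v * w * x) -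
         (1 - t * x) * (1 - a * w * x) * (1 - a * v * x) * (1 - a * a * t * v * w * x) =
         (t - 1) * x * (1 - a * v) * (1 - a * w) * (1 - a * a * t * v * w * x * x)"
  by algebra

lemma bracket_identity:
  fixes q a t v w :: complex and f G k e :: "complex fps"
  assumes t: "t \<noteq> 0" and q: "q = a * a * t"
    and G: "G = (1 - fps_const (a * t) * fps_X) * k" "fps_scale q G = (1 - fps_const a * fps_X) * k"
    and f: "f = (1 - fps_X) * e"
  shows "(1 - fps_X) * (fps_scale w G * fps_scale v G * fps_scale (v * w) (theta_plus q t * fps_scale q f)) -
         (1 - fps_const t * fps_X) * (fps_scale (q * w) G * fps_scale (q * v) G * fps_scale (q * v * w) f) =
         fps_const (t - 1) * fps_X * fps_const ((1 - a * v) * (1 - a * w)) *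
         (fps_scale (q * v * w) e * (1 - fps_const (q * v * w) * fps_X * fps_X) * fps_scale v k * fps_scale w k)"
proof -
  let ?E = "fps_scale (q * v * w) e" and ?c = fps_const and ?X = "fps_X :: complex fps"
  have th: "fps_scale (v * w) (theta_plus q t) * (1 - ?c (q * v * w) * ?X) = 1 - ?c (a * a * v * w) * ?X"
    using arg_cong[OF theta_plus_mult[of q t], of "fps_scale (v * w)"] t
    by (simp add: fps_scale_mult fps_scale_diff q mult_ac flip: fps_const_mult)
  have f1: "fps_scale (q * v * w) f = (1 - ?c (q * v * w) * ?X) * ?E"
    by (simp add: f fps_scale_mult fps_scale_diff)
  have G1: "fps_scale x G = (1 - ?c (a * t * x) * ?X) * fps_scale x k" for x
    by (simp add: G(1) fps_scale_mult fps_scale_diff mult_ac flip: fps_const_mult)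
  have G2: "fps_scale (q * x) G = (1 - ?c (a * x) * ?X) * fps_scale x k" for x
    using arg_cong[OF G(2), of "fps_scale x"]
    by (simp add: fps_scale_scale fps_scale_mult fps_scale_diff mult_ac flip: fps_const_mult)
  have f2: "fps_scale (v * w) (theta_plus q t * fps_scale q f) = (1 - ?c (a * a * v * w) * ?X) * ?E"
    by (simp add: fps_scale_mult fps_scale_scale mult.commute[of "v * w" q] f1 flip: th mult.assoc)
  have "(1 - ?X) * ((1 - ?c (a * t * w) * ?X) * fps_scale w k * ((1 - ?c (a * t * v) * ?X) * fps_scale v k) * ((1 - ?c (a * a * v * w) * ?X) * ?E)) -
      (1 - ?c t * ?X) * ((1 - ?c (a * w) * ?X) * fps_scale w k * ((1 - ?c (a * v) * ?X) * fps_scale v k) * ((1 - ?c (q * v * w) * ?X) * ?E)) =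
      ((1 - ?X) * (1 - ?c a * ?c t * ?c w * ?X) * (1 - ?c a * ?c t * ?c v * ?X) * (1 - ?c a * ?c a * ?c v * ?c w * ?X) -
         (1 - ?c t * ?X) * (1 - ?c a * ?c w * ?X) * (1 - ?c a * ?c v * ?X) * (1 - ?c a * ?c a * ?c t * ?c v * ?c w * ?X)) *
      (fps_scale w k * fps_scale v k * ?E)"
    by (simp only: q fps_const_mult [symmetric]) algebra
  also have "\<dots> = ?c (t - 1) * ?X * ?c ((1 - a * v) * (1 - a * w)) *
         (?E * (1 - ?c (q * v * w) * ?X * ?X) * fps_scale v k * fps_scale w k)"
    unfolding bracket_polynomial_identity
    by (simp only: q fps_const_mult [symmetric] fps_const_sub [symmetric] fps_const_1_eq_1) algebra
  finally show ?thesis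
    unfolding f2 unfolding f1 G2 unfolding G1 .
qed

subsection \<open>The integral as a pairing with polynomials\<close>

inductive bipoly :: "(complex \<Rightarrow> complex \<Rightarrow> complex) \<Rightarrow> bool" where
  bipoly_monom: "bipoly (\<lambda>v w. c * v ^ i * w ^ j)"
| bipoly_add: "bipoly p \<Longrightarrow> bipoly p' \<Longrightarrow> bipoly (\<lambda>v w. p v w + p' v w)"

lemma bipoly_const [intro!]: "bipoly (\<lambda>v w. c)"
  using bipoly_monom[of c 0 0] by simp

lemma bipoly_fst [intro!]: "bipoly (\<lambda>v w. v)"
  using bipoly_monom[of 1 1 0] by simp

lemma bipoly_snd [intro!]: "bipoly (\<lambda>v w. w)"
  using bipoly_monom[of 1 0 1] by simp

lemma bipoly_mult_monom:
  assumes "bipoly p"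
  shows "bipoly (\<lambda>v w. (c * v ^ i * w ^ j) * p v w)"
  using assms
proof induction
  case (bipoly_monom d k l)
  have "bipoly (\<lambda>v w. (c * d) * v ^ (i + k) * w ^ (j + l))"
    by (rule bipoly.bipoly_monom)
  then show ?case by (simp add: power_add mult_ac)
next
  case (bipoly_add p p')
  from bipoly.bipoly_add[OF bipoly_add.IH] show ?case by (simp add: distrib_left)
qed

lemma bipoly_mult:
  assumes "bipoly p" "bipoly p'"
  shows "bipoly (\<lambda>v w. p v w * p' v w)"
  using assms(1)
proof induction
  case (bipoly_monom c i j)
  show ?case by (rule bipoly_mult_monom[OF assms(2)])
next
  case (bipoly_add p1 p2)
  from bipoly.bipoly_add[OF bipoly_add.IH] show ?case by (simp add: distrib_right)
qed

lemma bipoly_diff: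
  assumes "bipoly p" "bipoly p'"
  shows "bipoly (\<lambda>v w. p v w - p' v w)"
  using bipoly_add[OF assms(1) bipoly_mult[OF bipoly_const[of "-1"] assms(2)]] by simp

lemma bipoly_power: "bipoly p \<Longrightarrow> bipoly (\<lambda>v w. p v w ^ n)"
  by (induction n) (auto intro: bipoly_mult)

lemma bipoly_sum: "(\<And>i. i \<in> S \<Longrightarrow> bipoly (p i)) \<Longrightarrow> bipoly (\<lambda>v w. \<Sum>i\<in>S. p i v w)"
  by (induction S rule: infinite_finite_induct) (auto intro: bipoly_add)

lemma bipoly_scale:
  assumes "bipoly p"
  shows "bipoly (\<lambda>v w. p (r * v) (s * w))"
  using assms
proof induction
  case (bipoly_monom c i j)
  have "bipoly (\<lambda>v w. (c * r ^ i * s ^ j) * v ^ i * w ^ j)"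
    by (rule bipoly.bipoly_monom)
  then show ?case by (simp add: power_mult_distrib mult_ac)
qed (rule bipoly.bipoly_add)

definition fps_bipoly :: "(complex \<Rightarrow> complex \<Rightarrow> complex fps) \<Rightarrow> bool" where
  "fps_bipoly V \<longleftrightarrow> (\<forall>n. bipoly (\<lambda>v w. fps_nth (V v w) n))"

lemma fps_bipoly_const: "fps_bipoly (\<lambda>v w. F)"
  by (auto simp: fps_bipoly_def)

lemma fps_bipoly_coeff: "bipoly p \<Longrightarrow> fps_bipoly (\<lambda>v w. fps_const (p v w))"
  unfolding fps_bipoly_def
proof
  show "bipoly (\<lambda>v w. fps_nth (fps_const (p v w)) n)" if "bipoly p" for n
    using that by (cases n) auto
qed

lemma fps_bipoly_diff: "fps_bipoly V \<Longrightarrow> fps_bipoly W \<Longrightarrow> fps_bipoly (\<lambda>v w. V v w - W v w)"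
  by (auto simp: fps_bipoly_def intro: bipoly_diff)

lemma fps_bipoly_mult: "fps_bipoly V \<Longrightarrow> fps_bipoly W \<Longrightarrow> fps_bipoly (\<lambda>v w. V v w * W v w)"
  by (auto simp: fps_bipoly_def fps_mult_nth intro!: bipoly_sum bipoly_mult)

lemma fps_bipoly_fps_scale: "bipoly p \<Longrightarrow> fps_bipoly V \<Longrightarrow> fps_bipoly (\<lambda>v w. fps_scale (p v w) (V v w))"
  by (auto simp: fps_bipoly_def intro!: bipoly_mult bipoly_power)

lemma fps_bipoly_arg_scale: "fps_bipoly V \<Longrightarrow> fps_bipoly (\<lambda>v w. V (r * v) (s * w))"
  by (auto simp: fps_bipoly_def intro: bipoly_scale)

lemmas fps_bipoly_intros =
  fps_bipoly_diff fps_bipoly_mult fps_bipoly_fps_scale fps_bipoly_coeff fps_bipoly_const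
  bipoly_diff bipoly_mult bipoly_const bipoly_fst bipoly_snd

locale torus_pairing =
  fixes k1 k2 :: "complex \<Rightarrow> complex" and P Q :: "nat \<Rightarrow> complex"
  assumes k1: "((\<lambda>u. k1 u * (1 / u) ^ i / (2 * of_real pi * \<i> * u)) has_contour_integral P i) (circlepath 0 1)"
    and k2: "((\<lambda>u. k2 u * u ^ i / (2 * of_real pi * \<i> * u)) has_contour_integral Q i) (circlepath 0 1)"
begin

definition inner_kernel :: "(complex \<Rightarrow> complex \<Rightarrow> complex) \<Rightarrow> complex \<Rightarrow> complex \<Rightarrow> complex" where
  "inner_kernel p u1 u2 = k1 u1 * k2 u2 * p (1 / u1) u2 / (2 * of_real pi * \<i> * u2)"

definition pairing :: "(complex \<Rightarrow> complex \<Rightarrow> complex) \<Rightarrow> complex" where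
  "pairing p = contour_integral (circlepath 0 1) (\<lambda>u1.
     contour_integral (circlepath 0 1) (inner_kernel p u1) / (2 * of_real pi * \<i> * u1))"

definition has_pairing :: "(complex \<Rightarrow> complex \<Rightarrow> complex) \<Rightarrow> complex \<Rightarrow> bool" where
  "has_pairing p z \<longleftrightarrow> (\<exists>J. (\<forall>u1. (inner_kernel p u1 has_contour_integral J u1) (circlepath 0 1)) \<and>
     ((\<lambda>u1. J u1 / (2 * of_real pi * \<i> * u1)) has_contour_integral z) (circlepath 0 1))"

lemma pairing_eqI:
  assumes "has_pairing p z"
  shows "pairing p = z"
proof -
  obtain J where J: "\<And>u. (inner_kernel p u has_contour_integral J u) (circlepath 0 1)"
    and z: "((\<lambda>u. J u / (2 * of_real pi * \<i> * u)) has_contour_integral z) (circlepath 0 1)"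
    using assms unfolding has_pairing_def by blast
  show ?thesis
    unfolding pairing_def contour_integral_unique[OF J] by (rule contour_integral_unique[OF z])
qed

lemma has_pairing_monom: "has_pairing (\<lambda>v w. c * v ^ i * w ^ j) (c * P i * Q j)"
  unfolding has_pairing_def
proof (intro exI[of _ "\<lambda>u. c * Q j * (k1 u * (1 / u) ^ i)"] conjI allI)
  fix u1
  have "((\<lambda>u. (k1 u1 * c * (1 / u1) ^ i) * (k2 u * u ^ j / (2 * of_real pi * \<i> * u)))
      has_contour_integral (k1 u1 * c * (1 / u1) ^ i) * Q j) (circlepath 0 1)"
    by (intro has_contour_integral_lmul k2)
  then show "(inner_kernel (\<lambda>v w. c * v ^ i * w ^ j) u1
      has_contour_integral c * Q j * (k1 u1 * (1 / u1) ^ i)) (circlepath 0 1)"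
    unfolding inner_kernel_def by (simp add: mult_ac)
  have "((\<lambda>u. (c * Q j) * (k1 u * (1 / u) ^ i / (2 * of_real pi * \<i> * u)))
      has_contour_integral (c * Q j) * P i) (circlepath 0 1)"
    by (intro has_contour_integral_lmul k1)
  then show "((\<lambda>u. c * Q j * (k1 u * (1 / u) ^ i) / (2 * of_real pi * \<i> * u))
      has_contour_integral c * P i * Q j) (circlepath 0 1)"
    by (simp add: mult_ac)
qed

lemma has_pairing_add:
  assumes "has_pairing p y" "has_pairing p' z"
  shows "has_pairing (\<lambda>v w. p v w + p' v w) (y + z)"
proof -
  obtain J J' where
    J: "\<And>u. (inner_kernel p u has_contour_integral J u) (circlepath 0 1)"
       "((\<lambda>u. J u / (2 * of_real pi * \<i> * u)) has_contour_integral y) (circlepath 0 1)" and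
    J': "\<And>u. (inner_kernel p' u has_contour_integral J' u) (circlepath 0 1)"
       "((\<lambda>u. J' u / (2 * of_real pi * \<i> * u)) has_contour_integral z) (circlepath 0 1)"
    using assms unfolding has_pairing_def by blast
  have "inner_kernel (\<lambda>v w. p v w + p' v w) u = (\<lambda>x. inner_kernel p u x + inner_kernel p' u x)" for u
    by (simp add: inner_kernel_def fun_eq_iff distrib_left add_divide_distrib)
  then show ?thesis
    unfolding has_pairing_def
    using has_contour_integral_add[OF J(1) J'(1)] has_contour_integral_add[OF J(2) J'(2)]
    by (intro exI[of _ "\<lambda>u. J u + J' u"]) (simp add: add_divide_distrib)
qed

lemma has_pairing_pairing:
  assumes "bipoly p"
  shows "has_pairing p (pairing p)"
proof -
  from assms have "\<exists>z. has_pairing p z"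
    by induction (blast intro: has_pairing_monom has_pairing_add)+
  then show ?thesis using pairing_eqI by metis
qed

lemma pairing_monom: "pairing (\<lambda>v w. c * v ^ i * w ^ j) = c * P i * Q j"
  by (rule pairing_eqI has_pairing_monom)+

lemma pairing_add: "bipoly p \<Longrightarrow> bipoly p' \<Longrightarrow> pairing (\<lambda>v w. p v w + p' v w) = pairing p + pairing p'"
  by (intro pairing_eqI has_pairing_add has_pairing_pairing)

lemma pairing_cmult:
  assumes "bipoly p"
  shows "pairing (\<lambda>v w. c * p v w) = c * pairing p"
  using assms
proof induction
  case (bipoly_monom d i j)
  then show ?case using pairing_monom[of "c * d" i j] pairing_monom[of d i j] by (simp add: mult_ac)
next
  case (bipoly_add p p')
  then show ?case
    by (simp add: distrib_left pairing_add bipoly_mult bipoly_const)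
qed

lemma pairing_sum:
  "(\<And>i. i \<in> S \<Longrightarrow> bipoly (p i)) \<Longrightarrow> pairing (\<lambda>v w. \<Sum>i\<in>S. p i v w) = (\<Sum>i\<in>S. pairing (p i))"
proof (induction S rule: infinite_finite_induct)
  case (insert x S)
  then show ?case by (simp add: pairing_add bipoly_sum)
qed (use pairing_monom[of 0 0 0] in simp_all)

definition fps_pairing :: "(complex \<Rightarrow> complex \<Rightarrow> complex fps) \<Rightarrow> complex fps" where
  "fps_pairing V = Abs_fps (\<lambda>n. pairing (\<lambda>v w. fps_nth (V v w) n))"

lemma torus_integral_eq_fps_pairing:
  "torus_integral (\<lambda>u1 u2. fps_const (k1 u1 * k2 u2) * V (1 / u1) u2) = fps_pairing V"
  by (simp add: torus_integral_def fps_pairing_def pairing_def inner_kernel_def[abs_def])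

lemma fps_pairing_add:
  "fps_bipoly V \<Longrightarrow> fps_bipoly W \<Longrightarrow> fps_pairing (\<lambda>v w. V v w + W v w) = fps_pairing V + fps_pairing W"
  by (simp add: fps_pairing_def fps_eq_iff fps_bipoly_def pairing_add)

lemma fps_pairing_mult_left:
  "fps_bipoly V \<Longrightarrow> fps_pairing (\<lambda>v w. F * V v w) = F * fps_pairing V"
  by (simp add: fps_pairing_def fps_eq_iff fps_bipoly_def fps_mult_nth pairing_sum pairing_cmult
      bipoly_mult bipoly_const)

lemma fps_pairing_diff:
  assumes "fps_bipoly V" "fps_bipoly W"
  shows "fps_pairing (\<lambda>v w. V v w - W v w) = fps_pairing V - fps_pairing W"
  using fps_pairing_add[OF assms(1) fps_bipoly_mult[OF fps_bipoly_const[of "-1"] assms(2)]]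
    fps_pairing_mult_left[OF assms(2), of "-1"] by simp

lemma fps_pairing_scale:
  "fps_bipoly V \<Longrightarrow> fps_pairing (\<lambda>v w. fps_scale c (V v w)) = fps_scale c (fps_pairing V)"
  by (simp add: fps_pairing_def fps_eq_iff fps_bipoly_def pairing_cmult)

lemma fps_pairing_shift_fst:
  assumes P: "\<And>i. q ^ i * (P i - a * P (Suc i)) = \<kappa> * (P i - P (Suc i) / a)" and V: "fps_bipoly V"
  shows "fps_pairing (\<lambda>v w. fps_const (1 - a * v) * V (q * v) w) =
         fps_const \<kappa> * fps_pairing (\<lambda>v w. fps_const (1 - v / a) * V v w)"
proof -
  have "pairing (\<lambda>v w. (1 - a * v) * p (q * v) w) = \<kappa> * pairing (\<lambda>v w. (1 - v / a) * p v w)"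
    if "bipoly p" for p
    using that
  proof induction
    case (bipoly_monom c i j)
    have 1: "(\<lambda>v w. (1 - a * v) * (c * (q * v) ^ i * w ^ j)) =
        (\<lambda>v w. c * q ^ i * v ^ i * w ^ j + (- (c * q ^ i * a)) * v ^ Suc i * w ^ j)"
      by (simp add: fun_eq_iff power_mult_distrib algebra_simps)
    have 2: "(\<lambda>v w. (1 - v / a) * (c * v ^ i * w ^ j)) =
        (\<lambda>v w. c * v ^ i * w ^ j + (- (c / a)) * v ^ Suc i * w ^ j)"
      by (simp add: fun_eq_iff algebra_simps)
    have "pairing (\<lambda>v w. (1 - a * v) * (c * (q * v) ^ i * w ^ j)) =
        c * Q j * (q ^ i * (P i - a * P (Suc i)))"
      unfolding 1 by (subst pairing_add) (simp_all only: bipoly.bipoly_monom pairing_monom, simp add: algebra_simps)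
    also have "\<dots> = \<kappa> * pairing (\<lambda>v w. (1 - v / a) * (c * v ^ i * w ^ j))"
      unfolding 2 P by (subst pairing_add) (simp_all only: bipoly.bipoly_monom pairing_monom, simp add: algebra_simps)
    finally show ?case .
  next
    case (bipoly_add p p')
    have "bipoly (\<lambda>v w. (1 - a * v) * p (q * v) w)" "bipoly (\<lambda>v w. (1 - v / a) * p v w)" if "bipoly p" for p
      using bipoly_mult[OF bipoly_diff[OF bipoly_const bipoly_mult[OF bipoly_const[of a] bipoly_fst]] bipoly_scale[OF that, of q 1], of 1]
        bipoly_mult[OF bipoly_diff[OF bipoly_const bipoly_mult[OF bipoly_const[of "1 / a"] bipoly_fst]] that, of 1]
      by simp_all
    with bipoly_add show ?case
      by (simp add: distrib_left pairing_add)
  qed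
  from this[of "\<lambda>v w. fps_nth (V v w) n" for n] V show ?thesis
    by (simp add: fps_pairing_def fps_eq_iff fps_bipoly_def)
qed

lemma fps_pairing_shift_snd:
  assumes Q: "\<And>j. Q j - Q (Suc j) / a = \<kappa> * q ^ j * (Q j - a * Q (Suc j))" and V: "fps_bipoly V"
  shows "fps_pairing (\<lambda>v w. fps_const (1 - w / a) * V v w) =
         fps_const \<kappa> * fps_pairing (\<lambda>v w. fps_const (1 - a * w) * V v (q * w))"
proof -
  have "pairing (\<lambda>v w. (1 - w / a) * p v w) = \<kappa> * pairing (\<lambda>v w. (1 - a * w) * p v (q * w))"
    if "bipoly p" for p
    using that
  proof induction
    case (bipoly_monom c i j)
    have 1: "(\<lambda>v w. (1 - a * w) * (c * v ^ i * (q * w) ^ j)) =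
        (\<lambda>v w. c * q ^ j * v ^ i * w ^ j + (- (c * q ^ j * a)) * v ^ i * w ^ Suc j)"
      by (simp add: fun_eq_iff power_mult_distrib algebra_simps)
    have 2: "(\<lambda>v w. (1 - w / a) * (c * v ^ i * w ^ j)) =
        (\<lambda>v w. c * v ^ i * w ^ j + (- (c / a)) * v ^ i * w ^ Suc j)"
      by (simp add: fun_eq_iff algebra_simps)
    have "pairing (\<lambda>v w. (1 - w / a) * (c * v ^ i * w ^ j)) = c * P i * (Q j - Q (Suc j) / a)"
      unfolding 2 by (subst pairing_add) (simp_all only: bipoly.bipoly_monom pairing_monom, simp add: algebra_simps)
    also have "\<dots> = \<kappa> * pairing (\<lambda>v w. (1 - a * w) * (c * v ^ i * (q * w) ^ j))"
      unfolding 1 Q by (subst pairing_add) (simp_all only: bipoly.bipoly_monom pairing_monom, simp add: algebra_simps)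
    finally show ?case .
  next
    case (bipoly_add p p')
    have "bipoly (\<lambda>v w. (1 - a * w) * p v (q * w))" "bipoly (\<lambda>v w. (1 - w / a) * p v w)" if "bipoly p" for p
      using bipoly_mult[OF bipoly_diff[OF bipoly_const bipoly_mult[OF bipoly_const[of a] bipoly_snd]] bipoly_scale[OF that, of 1 q], of 1]
        bipoly_mult[OF bipoly_diff[OF bipoly_const bipoly_mult[OF bipoly_const[of "1 / a"] bipoly_snd]] that, of 1]
      by simp_all
    with bipoly_add show ?case
      by (simp add: distrib_left pairing_add)
  qed
  from this[of "\<lambda>v w. fps_nth (V v w) n" for n] V show ?thesis
    by (simp add: fps_pairing_def fps_eq_iff fps_bipoly_def)
qed

end

context torus_pairing
begin

definition twisted_pairing :: "complex fps \<Rightarrow> complex fps \<Rightarrow> complex fps" where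
  "twisted_pairing G f = fps_pairing (\<lambda>v w. fps_scale w G * fps_scale v G * fps_scale (v * w) f)"

text \<open>The s_1-part of the commutator; with q, a, t replaced by their inverses it is the s_2-part.\<close>

lemma half_commutator:
  fixes q a t :: complex and f G H k e :: "complex fps"
  assumes t: "t \<noteq> 0" and q: "q = a * a * t"
    and G: "G = (1 - fps_const (a * t) * fps_X) * k" "fps_scale q G = (1 - fps_const a * fps_X) * k"
    and H: "(1 - fps_X) * (theta_plus q t * fps_scale q H) = (1 - fps_const t * fps_X) * H"
    and f: "f = (1 - fps_X) * e"
  shows "(1 - fps_X) * (H * twisted_pairing G (theta_plus q t * fps_scale q f) -
                        theta_plus q t * fps_scale q (H * twisted_pairing G f)) =
         H * fps_const (t - 1) * fps_X * fps_pairing (\<lambda>v w. fps_const ((1 - a * v) * (1 - a * w)) *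
         (fps_scale (q * v * w) e * (1 - fps_const (q * v * w) * fps_X * fps_X) * fps_scale v k * fps_scale w k))"
    (is "?lhs = H * fps_const _ * fps_X * fps_pairing ?Y")
proof -
  let ?A = "\<lambda>v w. fps_scale w G * fps_scale v G * fps_scale (v * w) (theta_plus q t * fps_scale q f)"
  let ?B = "\<lambda>v w. fps_scale (q * w) G * fps_scale (q * v) G * fps_scale (q * v * w) f"
  have bip: "fps_bipoly ?A" "fps_bipoly ?B" "fps_bipoly ?Y"
    by (intro fps_bipoly_intros)+
  have 1: "(1 - fps_X) * fps_pairing ?A - (1 - fps_const t * fps_X) * fps_pairing ?B =
      fps_const (t - 1) * fps_X * fps_pairing ?Y"
    using bracket_identity[OF t q G f] bip
    by (simp add: mult.assoc fps_bipoly_mult fps_bipoly_const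
        flip: fps_pairing_mult_left fps_pairing_diff)
  have 2: "fps_scale q (twisted_pairing G f) = fps_pairing ?B"
    unfolding twisted_pairing_def
    by (subst fps_pairing_scale [symmetric])
       (auto intro!: fps_bipoly_intros simp: fps_scale_mult fps_scale_scale mult_ac)
  have "?lhs = H * ((1 - fps_X) * twisted_pairing G (theta_plus q t * fps_scale q f)) -
      (1 - fps_X) * (theta_plus q t * fps_scale q H) * fps_scale q (twisted_pairing G f)"
    by (simp add: fps_scale_mult algebra_simps)
  also have "\<dots> = H * ((1 - fps_X) * fps_pairing ?A - (1 - fps_const t * fps_X) * fps_pairing ?B)"
    unfolding H 2 by (simp add: twisted_pairing_def algebra_simps)
  finally show ?thesis unfolding 1 by (simp add: mult.assoc)
qed

lemma commutator_eq_0: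
  fixes q a t s1 s2 \<kappa> \<mu> :: complex and f G H :: "complex fps"
  assumes q: "q \<noteq> 0" "q = a * a * t"
    and G: "(1 - fps_const a * fps_X) * G = (1 - fps_const (a * t) * fps_X) * fps_scale q G"
    and H: "(1 - fps_const q * fps_X) * (1 - fps_const t * fps_X) * H =
      (1 - fps_X) * (1 - fps_const (q / t) * fps_X) * fps_scale q H"
    and P: "\<And>i. q ^ i * (P i - a * P (Suc i)) = \<kappa> * (P i - P (Suc i) / a)"
    and Q: "\<And>j. Q j - Q (Suc j) / a = \<mu> * q ^ j * (Q j - a * Q (Suc j))"
    and \<kappa>\<mu>: "s1 * t * \<kappa> = s2 * \<mu>"
  shows "H * twisted_pairing G (D_op s1 s2 q t f) = D_op s1 s2 q t (H * twisted_pairing G f)"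
proof -
  have a: "a \<noteq> 0" and t: "t \<noteq> 0" using q by auto
  have unit: "1 - fps_const c * fps_X \<noteq> 0" for c :: complex
  proof -
    have "fps_nth (1 - fps_const c * fps_X) 0 \<noteq> 0" by simp
    then show ?thesis by (metis fps_zero_nth)
  qed
  define k where "k = G / (1 - fps_const (a * t) * fps_X)"
  have k: "G = (1 - fps_const (a * t) * fps_X) * k"
    unfolding k_def by (simp add: fps_divide_unit mult.left_commute inverse_mult_eq_1')
  have k': "fps_scale q G = (1 - fps_const a * fps_X) * k"
  proof -
    have "(1 - fps_const (a * t) * fps_X) * fps_scale q G = (1 - fps_const (a * t) * fps_X) * ((1 - fps_const a * fps_X) * k)"
      unfolding G[symmetric] by (subst k) (rule mult.left_commute)
    then show ?thesis using unit by simp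
  qed
  define k2 where "k2 = fps_scale (1 / q) k"
  have k2: "G = (1 - fps_const (1 / a * (1 / t)) * fps_X) * k2"
    "fps_scale (1 / q) G = (1 - fps_const (1 / a) * fps_X) * k2"
    using arg_cong[OF k', of "fps_scale (1 / q)"] arg_cong[OF k, of "fps_scale (1 / q)"] q a t
    by (simp_all add: fps_scale_scale fps_scale_mult fps_scale_diff k2_def mult_ac flip: fps_const_mult)
  define e where "e = f / (1 - fps_X)"
  have e: "f = (1 - fps_X) * e"
    unfolding e_def by (simp add: fps_divide_unit mult.left_commute inverse_mult_eq_1')
  have H1: "(1 - fps_X) * (theta_plus q t * fps_scale q H) = (1 - fps_const t * fps_X) * H"
  proof -
    have "(1 - fps_const q * fps_X) * ((1 - fps_X) * (theta_plus q t * fps_scale q H)) =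
        (1 - fps_X) * ((1 - fps_const q * fps_X) * theta_plus q t) * fps_scale q H"
      by (simp add: mult_ac)
    also have "\<dots> = (1 - fps_const q * fps_X) * ((1 - fps_const t * fps_X) * H)"
      unfolding theta_plus_mult H[symmetric] by (rule mult.assoc)
    finally show ?thesis using unit by simp
  qed
  have H2: "(1 - fps_X) * (theta_plus (1 / q) (1 / t) * fps_scale (1 / q) H) = (1 - fps_const (1 / t) * fps_X) * H"
  proof -
    let ?th = "theta_plus (1 / q) (1 / t)"
    have h: "(1 - fps_X) * (1 - fps_const (t / q) * fps_X) * fps_scale (1 / q) H =
        (1 - fps_const (1 / q) * fps_X) * (1 - fps_const (1 / t) * fps_X) * H"
      using arg_cong[OF H, of "fps_scale (1 / q)"] q t
      by (simp add: fps_scale_scale fps_scale_mult fps_scale_diff mult.assoc[symmetric])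
    have th: "(1 - fps_const (1 / q) * fps_X) * ?th = 1 - fps_const (t / q) * fps_X"
      using theta_plus_mult[of "1 / q" "1 / t"] by simp
    have "(1 - fps_const (1 / q) * fps_X) * ((1 - fps_X) * (?th * fps_scale (1 / q) H)) =
        (1 - fps_X) * ((1 - fps_const (1 / q) * fps_X) * ?th) * fps_scale (1 / q) H"
      by (simp add: mult_ac)
    also have "\<dots> = (1 - fps_const (1 / q) * fps_X) * ((1 - fps_const (1 / t) * fps_X) * H)"
      unfolding th h by (rule mult.assoc)
    finally show ?thesis using unit by simp
  qed
  define Z where "Z = (\<lambda>v w. fps_scale (v * w) e * (1 - fps_const (v * w) * fps_X * fps_X) *
    fps_scale (v / q) k * fps_scale w k)"
  have Z: "fps_bipoly Z"
    unfolding Z_def divide_inverse by (intro fps_bipoly_intros)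
  define Y where "Y = fps_pairing (\<lambda>v w. fps_const ((1 - v / a) * (1 - a * w)) * Z v w)"
  have Y1: "fps_pairing (\<lambda>v w. fps_const ((1 - a * v) * (1 - a * w)) *
      (fps_scale (q * v * w) e * (1 - fps_const (q * v * w) * fps_X * fps_X) * fps_scale v k * fps_scale w k)) =
      fps_const \<kappa> * Y"
  proof -
    have "fps_bipoly (\<lambda>v w. fps_const (1 - a * w) * Z v w)"
      using Z by (intro fps_bipoly_intros)
    from fps_pairing_shift_fst[where a = a, OF P this] show ?thesis using q(1)
      by (simp add: Y_def Z_def mult_ac flip: fps_const_mult)
  qed
  have Y2: "fps_pairing (\<lambda>v w. fps_const ((1 - 1 / a * v) * (1 - 1 / a * w)) *
      (fps_scale (1 / q * v * w) e * (1 - fps_const (1 / q * v * w) * fps_X * fps_X) * fps_scale v k2 * fps_scale w k2)) =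
      fps_const \<mu> * Y"
  proof -
    have "fps_bipoly (\<lambda>v w. fps_const (1 - v * (1 / a)) * Z v (w / q))"
      using fps_bipoly_arg_scale[OF Z, of 1 "1 / q"] by (intro fps_bipoly_intros) auto
    from fps_pairing_shift_snd[where a = a, OF Q this] show ?thesis using q(1)
      by (simp add: Y_def Z_def k2_def fps_scale_scale divide_inverse mult_ac flip: fps_const_mult)
  qed
  have t': "1 / t \<noteq> 0" and q': "1 / q = 1 / a * (1 / a) * (1 / t)"
    using q t by simp_all
  have "(1 - fps_X) * (H * twisted_pairing G (D_op s1 s2 q t f) - D_op s1 s2 q t (H * twisted_pairing G f)) =
     fps_const s1 * ((1 - fps_X) * (H * twisted_pairing G (theta_plus q t * fps_scale q f) -
                        theta_plus q t * fps_scale q (H * twisted_pairing G f))) +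
     fps_const s2 * ((1 - fps_X) * (H * twisted_pairing G (theta_plus (1 / q) (1 / t) * fps_scale (1 / q) f) -
                        theta_plus (1 / q) (1 / t) * fps_scale (1 / q) (H * twisted_pairing G f)))"
  proof -
    have lin: "twisted_pairing G (fps_const c * F + fps_const d * F') =
        fps_const c * twisted_pairing G F + fps_const d * twisted_pairing G F'" for c d F F'
      unfolding twisted_pairing_def
      by (simp add: fps_scale_add fps_scale_mult distrib_left mult.left_commute[of _ "fps_const _"]
          fps_pairing_add fps_pairing_mult_left fps_bipoly_intros)
    show ?thesis
      by (simp add: D_op_def T1_def T2_def theta_minus_eq mult.assoc lin) (simp add: algebra_simps)
  qed
  also have "\<dots> = fps_const (s1 * (t - 1) * \<kappa> + s2 * (1 / t - 1) * \<mu>) * (H * fps_X * Y)"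
    unfolding half_commutator[OF t q(2) k k' H1 e] Y1 half_commutator[OF t' q' k2 H2 e] Y2
    by (simp only: fps_const_mult [symmetric] fps_const_add [symmetric]) algebra
  also have "s1 * (t - 1) * \<kappa> + s2 * (1 / t - 1) * \<mu> = (1 - 1 / t) * (s1 * t * \<kappa> - s2 * \<mu>)"
    using t by (simp add: field_simps)
  also have "\<dots> = 0" using \<kappa>\<mu> by simp
  finally show ?thesis using unit[of 1] by simp
qed

end

text \<open>
  For |t| > 1 a zero u of the denominator Theta q (qh / th / u) may lie on the unit circle.
  There the integrand has the junk value 0, which the integral does not see.
\<close>

lemma qpoch_inf_zero_on_circle_unique:
  assumes "q \<noteq> 0" "norm q < 1"
  shows "\<exists>p. \<forall>u. norm u = 1 \<longrightarrow> u \<noteq> p \<longrightarrow> qpoch_inf (b * u) q \<noteq> 0"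
proof (rule ccontr)
  assume "\<not> ?thesis"
  then have *: "\<exists>u. norm u = 1 \<and> u \<noteq> p \<and> qpoch_inf (b * u) q = 0" for p by blast
  obtain u where u: "norm u = 1" "qpoch_inf (b * u) q = 0" using * by blast
  obtain u' where u': "norm u' = 1" "u' \<noteq> u" "qpoch_inf (b * u') q = 0" using *[of u] by blast
  obtain i where i: "b * u * q ^ i = 1" using u qpoch_inf_eq_0_iff[OF assms(2)] by blast
  obtain j where j: "b * u' * q ^ j = 1" using u' qpoch_inf_eq_0_iff[OF assms(2)] by blast
  have b: "b \<noteq> 0" using i by auto
  have "norm b * norm q ^ i = 1" "norm b * norm q ^ j = 1"
    using arg_cong[OF i, of norm] arg_cong[OF j, of norm] u u' by (simp_all add: norm_mult norm_power)
  then have "norm q ^ i = norm q ^ j" using b by (metis mult_left_cancel norm_eq_zero)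
  then have "i = j" using assms power_inject_exp'[of "norm q" i j] by auto
  then have "b * q ^ j * u = b * q ^ j * u'" using i j by (simp add: mult_ac)
  then show False using b assms u' by simp
qed

lemma integrand_factor_moment:
  fixes q qh th c :: complex
  assumes q: "q \<noteq> 0" "norm q < 1" "qh * qh = q" and th: "th \<noteq> 0" "norm (qh / th) < 1"
    and c: "c \<noteq> 0"
  shows "((\<lambda>u. Theta q (c * (qh / th) * (1 / u)) / Theta q (qh / th * (1 / u)) * g_fun q qh th u *
            u powi n / (2 * of_real pi * \<i> * u)) has_contour_integral moment q (qh / th) c n) (circlepath 0 1)"
proof -
  let ?a = "qh / th"
  obtain p where p: "\<And>u. norm u = 1 \<Longrightarrow> u \<noteq> p \<Longrightarrow> qpoch_inf (qh * th * u) q \<noteq> 0"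
    using qpoch_inf_zero_on_circle_unique[OF q(1,2)] by blast
  have qq: "qpoch_inf q q \<noteq> 0" using q by (intro qpoch_inf_nonzero)
  have "Theta q (c * ?a * (1 / u)) / Theta q (?a * (1 / u)) * g_fun q qh th u = theta_kernel q ?a c u"
    if "norm u = 1" "u \<noteq> p" for u
  proof -
    define b where "b = qpoch_inf (qh * th * u) q"
    have "b \<noteq> 0" using p that by (simp add: b_def)
    have "qh \<noteq> 0" using q by auto
    then have "q / (?a * (1 / u)) = qh * th * u" using th by (simp flip: q(3))
    moreover have "q / (c * ?a * (1 / u)) = q * u / (c * ?a)" by simp
    ultimately show ?thesis
      unfolding Theta_def theta_kernel_def g_fun_def b_def[symmetric] using \<open>b \<noteq> 0\<close> qq
      by (simp add: b_def[symmetric] del: divide_divide_eq_right divide_divide_eq_left times_divide_eq_right times_divide_eq_left)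
         (simp add: b_def[symmetric])
  qed
  then show ?thesis
    by (intro has_contour_integral_circlepath_spike[where p = p,
        OF has_contour_integral_integral[OF theta_kernel_contour_integrable[OF q(2) th(2), of c n], folded moment_def]])
      simp
qed

theorem proposition2p6:
  fixes \<alpha> s1 s2 q t qh th :: complex and f :: "complex fps"
  assumes "q \<noteq> 0" and "norm q < 1" and "norm q < norm t"
    and "qh ^ 2 = q" and "th ^ 2 = t"
    and "\<alpha> \<noteq> 0" and "s1 \<noteq> 0" and "s2 \<noteq> 0"
    and "qpoch_inf (\<alpha> / s1 * q / t) q \<noteq> 0" and "qpoch_inf (s1 / \<alpha> * q) q \<noteq> 0"
    and "qpoch_inf (\<alpha> / s2 * q / t) q \<noteq> 0" and "qpoch_inf (s2 / \<alpha> * q) q \<noteq> 0"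
  shows "I_op \<alpha> s1 s2 q t qh th (D_op s1 s2 q t f) - D_op s1 s2 q t (I_op \<alpha> s1 s2 q t qh th f) = 0"
proof -
  define a c1 c2 where "a = qh / th" and "c1 = \<alpha> / s1" and "c2 = \<alpha> / s2"
  define G H where "G = fps_expansion (g_fun q qh th) 0" and "H = fps_expansion (h_fun q t) 0"
  define k where "k = (\<lambda>c u. Theta q (c * a * (1 / u)) / Theta q (a * (1 / u)) * g_fun q qh th u)"
  have t: "t \<noteq> 0" and th: "th \<noteq> 0" and qh: "qh \<noteq> 0" and c: "c1 \<noteq> 0" "c2 \<noteq> 0"
    using assms by (auto simp: c1_def c2_def)
  have aat: "q = a * a * t" and at: "qh * th = a * t" and qq: "qh * qh = q"
    using assms(4,5) th by (auto simp: a_def power2_eq_square)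
  have a: "a \<noteq> 0" "norm a < 1"
  proof -
    have "norm a ^ 2 = norm q / norm t"
      unfolding aat using t by (simp add: norm_mult power2_eq_square)
    also have "\<dots> < 1 ^ 2" using assms(3) t by simp
    finally show "norm a < 1" by (rule power_less_imp_less_base) simp
  qed (use qh th in \<open>simp add: a_def\<close>)
  have mom: "((\<lambda>u. k c u * u powi n / (2 * of_real pi * \<i> * u)) has_contour_integral moment q a c n) (circlepath 0 1)"
    if "c \<noteq> 0" for c n
    using integrand_factor_moment[OF assms(1,2) qq th _ that, of n] a by (simp add: k_def a_def)
  interpret torus_pairing "k c1" "k c2" "\<lambda>i. moment q a c1 (- int i)" "\<lambda>j. moment q a c2 (int j)"
    by standard (use mom[OF c(1), of "- int i" for i] mom[OF c(2), of "int j" for j] in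
      \<open>simp_all add: power_int_minus inverse_eq_divide power_one_over\<close>)
  have I: "I_op \<alpha> s1 s2 q t qh th F =
      fps_const (I_factor \<alpha> s1 q t * I_factor \<alpha> s2 q t) * (H * twisted_pairing G F)" for F
  proof -
    have "I_integrand \<alpha> s1 s2 q qh th F = (\<lambda>u1 u2. fps_const (k c1 u1 * k c2 u2) *
        (fps_scale u2 G * fps_scale (1 / u1) G * fps_scale (1 / u1 * u2) F))"
      by (simp add: I_integrand_def fun_eq_iff k_def a_def c1_def c2_def G_def mult_ac flip: fps_const_mult)
    then show ?thesis
      using torus_integral_eq_fps_pairing[of "\<lambda>v w. fps_scale w G * fps_scale v G * fps_scale (v * w) F"]
      by (simp add: I_op_def H_def twisted_pairing_def mult.assoc)
  qed
  have "H * twisted_pairing G (D_op s1 s2 q t f) = D_op s1 s2 q t (H * twisted_pairing G f)"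
  proof (rule commutator_eq_0[OF assms(1) aat, where \<kappa> = "c1 / t" and \<mu> = c2])
    show "(1 - fps_const a * fps_X) * G = (1 - fps_const (a * t) * fps_X) * fps_scale q G"
      using g_fun_fps_expansion[OF assms(2), of qh th] by (simp add: G_def at a_def)
    show "(1 - fps_const q * fps_X) * (1 - fps_const t * fps_X) * H =
      (1 - fps_X) * (1 - fps_const (q / t) * fps_X) * fps_scale q H"
      using h_fun_fps_expansion[OF assms(2)] by (simp add: H_def)
    show "q ^ i * (moment q a c1 (- int i) - a * moment q a c1 (- int (Suc i))) =
        c1 / t * (moment q a c1 (- int i) - moment q a c1 (- int (Suc i)) / a)" for i
    proof -
      define x y where "x = moment q a c1 (- int i)" and "y = moment q a c1 (- int (Suc i))"
      have "x - a * y = - (c1 * a / q) * q powi (- int i) * (y - a * x)"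
      proof -
        have suc: "- int (Suc i) = - int i - 1" by simp
        show ?thesis
          unfolding x_def y_def suc by (rule moment_recurrence[OF assms(1,2) a c(1)])
      qed
      then have "q ^ i * (x - a * y) = - (c1 * a / q) * (y - a * x)"
        using assms(1) by (simp add: power_int_minus)
      also have "\<dots> = c1 / t * (x - y / a)"
        using a t by (simp add: aat field_simps)
      finally show ?thesis by (simp add: x_def y_def)
    qed
    show "moment q a c2 (int j) - moment q a c2 (int (Suc j)) / a =
        c2 * q ^ j * (moment q a c2 (int j) - a * moment q a c2 (int (Suc j)))" for j
    proof -
      define x y where "x = moment q a c2 (int j)" and "y = moment q a c2 (int (Suc j))"
      have "y - a * x = - (c2 * a / q) * q powi (int (Suc j)) * (x - a * y)"
        using moment_recurrence[OF assms(1,2) a c(2), of "int (Suc j)"] by (simp add: x_def y_def)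
      then have "y - a * x = - a * (c2 * q ^ j * (x - a * y))"
        using assms(1) by (simp add: power_int_add)
      then show ?thesis
        using a unfolding x_def[symmetric] y_def[symmetric] by (simp add: field_simps)
    qed
    show "s1 * t * (c1 / t) = s2 * c2"
      using t assms by (simp add: c1_def c2_def)
  qed
  moreover have "D_op s1 s2 q t (fps_const C * F) = fps_const C * D_op s1 s2 q t F" for C F
    by (simp add: D_op_def T1_def T2_def fps_scale_mult algebra_simps)
  ultimately show ?thesis
    by (simp add: I)
qed

end
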